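(* Let $a,b,c,d\in\mathbb{Q}$ with $a\neq 0$ and $c\neq 0$, and for $n\in\mathbb{Z}$ put $$w_n=(an+b)F_n+(cn+d)F_{n-1}.$$ Then $(w_n)$ is an integer sequence (i.e. $w_n\in\mathbb{Z}$ for all $n$) if and only if $d\in\mathbb{Z}$ and there exist integers $z_1,z_2,z_3$ such that $$a=\frac{-z_1-3z_2+2z_3}{5},\quad b=\frac{6z_1+3z_2-2z_3}{5},\quad c=\frac{-2z_1+4z_2-z_3}{5}.$$
   Context: $(F_n)$ is the Fibonacci sequence: $F_0=0$, $F_1=1$, $F_n=F_{n-1}+F_{n-2}$, extended to negative indices by the same recurrence, so that $F_{-n}=(-1)^{n+1}F_n$ (in particular $F_{-1}=1$). *)

theory Defs
  imports Complex_Main "HOL-Number_Theory.Fib"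
begin

text \<open>The bi-infinite Fibonacci sequence. The values at negative indices are the ones forced by
  the recurrence (lemmas \<open>fibZ_rec\<close> and \<open>fibZ_unique\<close>).\<close>

definition fibZ :: "int \<Rightarrow> int" where
  "fibZ n = (if 0 \<le> n then int (fib (nat n)) else (-1) ^ (nat (- n) + 1) * int (fib (nat (- n))))"

lemma fibZ_0 [simp]: "fibZ 0 = 0"
  and fibZ_1 [simp]: "fibZ 1 = 1"
  and fibZ_minus_1 [simp]: "fibZ (- 1) = 1"
  by (simp_all add: fibZ_def)

lemma fibZ_rec: "fibZ n = fibZ (n - 1) + fibZ (n - 2)"
proof -
  consider "n \<ge> 2" | "n = 1" | "n = 0" | "n < 0" by linarith
  then show ?thesis
  proof cases
    case 1
    define k where "k = nat (n - 2)"
    have "nat n = Suc (Suc k)" "nat (n - 1) = Suc k" "nat (n - 2) = k"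
      using 1 by (simp_all add: k_def)
    then show ?thesis using 1 unfolding fibZ_def by simp
  next
    case 2
    then show ?thesis by simp
  next
    case 3
    have "fibZ (- 2) = - 1"
      by (simp add: fibZ_def fib.simps eval_nat_numeral)
    then show ?thesis using 3 by simp
  next
    case 4
    define k where "k = nat (- n - 1)"
    have k: "nat (- n) = Suc k" "nat (- (n - 1)) = Suc (Suc k)" "nat (- (n - 2)) = Suc (Suc (Suc k))"
      using 4 by (simp_all add: k_def)
    have neg: "\<not> 0 \<le> n" "\<not> 0 \<le> n - 1" "\<not> 0 \<le> n - 2"
      using 4 by simp_all
    show ?thesis unfolding fibZ_def k if_not_P [OF neg(1)] if_not_P [OF neg(2)] if_not_P [OF neg(3)]
      by (simp add: algebra_simps)
  qed
qed

lemma fibZ_unique: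
  fixes G :: "int \<Rightarrow> int"
  assumes "G 0 = 0" "G 1 = 1" and rec: "\<And>n. G n = G (n - 1) + G (n - 2)"
  shows "G = fibZ"
proof
  fix n
  have "G n = fibZ n \<and> G (n + 1) = fibZ (n + 1)"
  proof (induction n rule: int_induct [where k = 0])
    case base
    show ?case using assms(1,2) by simp
  next
    case (step1 i)
    then show ?case using rec [of "i + 1 + 1"] fibZ_rec [of "i + 1 + 1"] by (simp add: algebra_simps)
  next
    case (step2 i)
    then show ?case using rec [of "i + 1"] fibZ_rec [of "i + 1"] by (simp add: algebra_simps)
  qed
  then show "G n = fibZ n" ..
qed

definition w :: "rat \<Rightarrow> rat \<Rightarrow> rat \<Rightarrow> rat \<Rightarrow> int \<Rightarrow> rat" where
  "w a b c d n = (a * of_int n + b) * of_int (fibZ n) + (c * of_int n + d) * of_int (fibZ (n - 1))"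

end

theory Submission
  imports Defs
begin

text \<open>Since \<open>n F\<^sub>n\<close> and \<open>F\<^sub>n\<close> are both annihilated by \<open>(E\<^sup>2 - E - 1)\<^sup>2\<close> with \<open>E\<close> the shift, \<open>w\<close>
  satisfies a recurrence of order four with integer coefficients and outer coefficients \<open>\<plusminus>1\<close>. So
  \<open>w\<close> is integral iff \<open>w\<^sub>0 = d\<close>, \<open>w\<^sub>1\<close>, \<open>w\<^sub>2\<close>, \<open>w\<^sub>3\<close> are integers, and the stated parametrization
  is the solution of \<open>w\<^sub>1 = z\<^sub>1\<close>, \<open>w\<^sub>2 = z\<^sub>2 + d\<close>, \<open>w\<^sub>3 = z\<^sub>3 + d\<close> for \<open>a\<close>, \<open>b\<close>, \<open>c\<close>.\<close>

text \<open>Once every Fibonacci value is expressed through \<open>fibZ n\<close> and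
  \<open>fibZ (n - 1)\<close>, this is a polynomial identity in \<open>n\<close> and these two
  values.\<close>

lemma w_rec: "w a b c d (n + 4) = 2 * w a b c d (n + 3) + w a b c d (n + 2)
    - 2 * w a b c d (n + 1) - w a b c d n"
proof -
  have F1: "fibZ (n + 1) = fibZ n + fibZ (n - 1)"
    using fibZ_rec [of "n + 1"] by (simp add: algebra_simps)
  have F2: "fibZ (n + 2) = 2 * fibZ n + fibZ (n - 1)"
    using fibZ_rec [of "n + 2"] F1 by (simp add: algebra_simps)
  have F3: "fibZ (n + 3) = 3 * fibZ n + 2 * fibZ (n - 1)"
    using fibZ_rec [of "n + 3"] F1 F2 by (simp add: algebra_simps)
  have F4: "fibZ (n + 4) = 5 * fibZ n + 3 * fibZ (n - 1)"
    using fibZ_rec [of "n + 4"] F2 F3 by (simp add: algebra_simps)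
  have shifts: "n + 4 - 1 = n + 3" "n + 3 - 1 = n + 2" "n + 2 - 1 = n + 1" "n + 1 - 1 = n"
    by simp_all
  show ?thesis
    unfolding w_def shifts F1 F2 F3 F4 by (simp add: algebra_simps)
qed

lemma w_initial:
  "w a b c d 0 = d" "w a b c d 1 = a + b"
  "w a b c d 2 = 2 * a + b + 2 * c + d" "w a b c d 3 = 6 * a + 2 * b + 3 * c + d"
proof -
  have "fibZ 2 = 1" "fibZ 3 = 2"
    using fibZ_rec [of 2] fibZ_rec [of 3] by simp_all
  then show "w a b c d 0 = d" "w a b c d 1 = a + b"
    "w a b c d 2 = 2 * a + b + 2 * c + d" "w a b c d 3 = 6 * a + 2 * b + 3 * c + d"
    by (simp_all add: w_def algebra_simps)
qed

lemma w_integral_iff: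
  "(\<forall>n. w a b c d n \<in> \<int>) \<longleftrightarrow>
    w a b c d 0 \<in> \<int> \<and> w a b c d 1 \<in> \<int> \<and> w a b c d 2 \<in> \<int> \<and> w a b c d 3 \<in> \<int>"
    (is "_ \<longleftrightarrow> ?init")
proof
  assume init: ?init
  have "w a b c d n \<in> \<int> \<and> w a b c d (n + 1) \<in> \<int> \<and> w a b c d (n + 2) \<in> \<int> \<and> w a b c d (n + 3) \<in> \<int>"
    for n
  proof (induction n rule: int_induct [where k = 0])
    case base
    show ?case using init by simp
  next
    case (step1 i)
    then have "w a b c d (i + 4) \<in> \<int>"
      unfolding w_rec by (intro Ints_diff Ints_add Ints_mult) simp_all
    with step1 show ?case by (simp add: add.assoc)
  next
    case (step2 i)
    \<comment> \<open>The lowest term of \<open>w_rec\<close> has coefficient -1, so solving for it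
      needs no division.\<close>
    have "w a b c d (i - 1) = 2 * w a b c d (i + 2) + w a b c d (i + 1)
        - 2 * w a b c d i - w a b c d (i + 3)"
      using w_rec [of a b c d "i - 1"] by (simp add: algebra_simps)
    then have "w a b c d (i - 1) \<in> \<int>"
      using step2 by (simp only:) (intro Ints_diff Ints_add Ints_mult; simp)
    with step2 show ?case by (simp add: algebra_simps)
  qed
  then show "\<forall>n. w a b c d n \<in> \<int>" by blast
qed simp

theorem theorem1:
  fixes a b c d :: rat
  assumes "a \<noteq> 0" and "c \<noteq> 0"
  shows "(\<forall>n::int. w a b c d n \<in> \<int>) \<longleftrightarrow>
    d \<in> \<int> \<and>
    (\<exists>z1 z2 z3 :: int.
      a = (- of_int z1 - 3 * of_int z2 + 2 * of_int z3) / 5 \<and>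
      b = (6 * of_int z1 + 3 * of_int z2 - 2 * of_int z3) / 5 \<and>
      c = (- 2 * of_int z1 + 4 * of_int z2 - of_int z3) / 5)"
proof -
  \<comment> \<open>The linear system in \<open>a\<close>, \<open>b\<close>, \<open>c\<close> on the
    right has determinant 5, hence the denominators.\<close>
  have solve: "a = (- x - 3 * y + 2 * z) / 5 \<and> b = (6 * x + 3 * y - 2 * z) / 5 \<and>
      c = (- 2 * x + 4 * y - z) / 5 \<longleftrightarrow>
      a + b = x \<and> 2 * a + b + 2 * c = y \<and> 6 * a + 2 * b + 3 * c = z" for x y z
    by (auto simp: field_simps)
  have "(\<forall>n. w a b c d n \<in> \<int>) \<longleftrightarrow> d \<in> \<int> \<and> a + b \<in> \<int> \<and>
      2 * a + b + 2 * c + d \<in> \<int> \<and> 6 * a + 2 * b + 3 * c + d \<in> \<int>"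
    by (simp only: w_integral_iff w_initial)
  also have "\<dots> \<longleftrightarrow> d \<in> \<int> \<and> a + b \<in> \<int> \<and> 2 * a + b + 2 * c \<in> \<int> \<and> 6 * a + 2 * b + 3 * c \<in> \<int>"
    by auto
  also have "\<dots> \<longleftrightarrow> d \<in> \<int> \<and> (\<exists>z1 z2 z3 :: int. a + b = of_int z1 \<and>
      2 * a + b + 2 * c = of_int z2 \<and> 6 * a + 2 * b + 3 * c = of_int z3)"
    by (auto simp: Ints_def image_iff)
  finally show ?thesis
    unfolding solve .
qed

end
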